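(* Let $n\ge 1$ be an integer. For any sequence $v_1,v_2,\dots,v_n$ of unit vectors in a real Hilbert space $\mathcal{H}$, there exists a unit vector $v$ in $\mathcal{H}$ such that $$|\langle v_k,v\rangle|\ \geq\ \sin\left(\frac{\pi}{2n}\right)$$ for all $k\in\{1,\dots,n\}$.
   Context: $\langle\cdot,\cdot\rangle$ denotes the inner product of $\mathcal{H}$; a unit vector is a vector of norm $1$. The vectors $v_1,\dots,v_n$ are not assumed to be distinct. *)

theory Defs imports "HOL-Analysis.Inner_Product"
begin

end

theory Submission
  imports Defs "HOL-Analysis.Analysis" "HOL-Computational_Algebra.Polynomial"
begin

text \<open>
  Let \<open>P x\<close> be the product of the inner products of \<open>x\<close> with the given vectors, and let \<open>w\<close> maximise
  \<open>\<bar>P\<bar>\<close> on the unit sphere of their span. On every great circle through \<open>w\<close>, \<open>P\<close> is a form of degree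
  \<open>n\<close> in \<open>cos t\<close> and \<open>sin t\<close> with its maximal modulus at \<open>w\<close>, and such a form has no zero at
  distance less than \<open>pi / (2 * n)\<close> from its maximum (M. Riesz). So \<open>w\<close> has angular distance at least
  \<open>pi / (2 * n)\<close> from each of the hyperplanes orthogonal to the given vectors.
\<close>

section \<open>Counting zeros of trigonometric forms\<close>

text \<open>Zeros in an open interval of length \<open>pi\<close> inject, via
  \<open>cis (2 * t)\<close>, into the roots of a complex polynomial of degree at most
  \<open>card I\<close>. The point \<open>t0\<close> only certifies that this polynomial is not
  zero.\<close>

lemma card_zeros_trig_form_le:
  fixes a b :: "'i \<Rightarrow> real" and I :: "'i set" and L C s t0 :: real
  defines "f \<equiv> \<lambda>t. L * cos (real (card I) * (t - s)) - C * (\<Prod>k\<in>I. a k * cos t + b k * sin t)"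
  assumes "finite I" and "f t0 \<noteq> 0"
  shows "finite {t\<in>{s<..<s + pi}. f t = 0}" and "card {t\<in>{s<..<s + pi}. f t = 0} \<le> card I"
proof -
  define n where "n = card I"
  \<comment> \<open>After multiplication by \<open>cis t ^ n\<close>, \<open>f\<close> is a polynomial of degree at most \<open>n\<close> in \<open>cis (2 * t)\<close>.\<close>
  define q where "q = (\<Prod>k\<in>I. [:Complex (a k / 2) (b k / 2), Complex (a k / 2) (- b k / 2):])"
  define p :: "complex poly" where
    "p = smult (of_real L / 2) (monom (cis (- (real n * s))) n + [:cis (real n * s):])
       - smult (of_real C) q"
  \<comment> \<open>With \<open>c = Complex x y\<close> the left side is
    \<open>c + cnj c * cis (2 * t)\<close>; pulling out \<open>cis t\<close> leaves a number plus
    its conjugate, hence a real one.\<close>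
  have factor: "poly [:Complex x y, Complex x (- y):] (cis (2 * t))
      = cis t * of_real (2 * x * cos t + 2 * y * sin t)" for x y t
  proof -
    have "cis (2 * t) = cis t * cis t" by (simp add: cis_mult)
    moreover have "Complex x y + cis t * cis t * Complex x (- y)
        = cis t * (cis (- t) * Complex x y + cis t * Complex x (- y))"
      by (simp add: distrib_left mult.assoc[symmetric] cis_mult)
    moreover have "cis (- t) * Complex x y + cis t * Complex x (- y)
        = of_real (2 * x * cos t + 2 * y * sin t)"
      by (simp add: complex_eq_iff algebra_simps)
    ultimately show ?thesis by simp
  qed
  have p_cis: "poly p (cis (2 * t)) = cis t ^ n * of_real (f t)" for t
  proof -
    have "poly q (cis (2 * t))
        = (\<Prod>k\<in>I. cis t * of_real (a k * cos t + b k * sin t))"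
      unfolding q_def poly_prod using factor[of "a _ / 2" "b _ / 2" t] by (intro prod.cong) simp_all
    also have "\<dots> = cis t ^ n * of_real (\<Prod>k\<in>I. a k * cos t + b k * sin t)"
      by (simp add: prod.distrib n_def)
    finally have 1: "poly q (cis (2 * t))
        = cis t ^ n * of_real (\<Prod>k\<in>I. a k * cos t + b k * sin t)" .
    have "real n * t + real n * (t - s) = - (real n * s) + real n * (2 * t)"
      and "real n * t + - (real n * (t - s)) = real n * s" by (simp_all add: algebra_simps)
    then have "cis (- (real n * s)) * cis (2 * t) ^ n + cis (real n * s)
        = cis t ^ n * (cis (real n * (t - s)) + cis (- (real n * (t - s))))"
      by (simp only: Complex.DeMoivre distrib_left cis_mult)
    also have "cis (real n * (t - s)) + cis (- (real n * (t - s))) = of_real (2 * cos (real n * (t - s)))"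
      by (simp add: complex_eq_iff)
    finally have 2: "cis (- (real n * s)) * cis (2 * t) ^ n + cis (real n * s)
        = cis t ^ n * of_real (2 * cos (real n * (t - s)))" .
    have "poly p (cis (2 * t)) = of_real L / 2 * (cis (- (real n * s)) * cis (2 * t) ^ n + cis (real n * s))
        - of_real C * poly q (cis (2 * t))"
      by (simp add: p_def poly_monom)
    also have "\<dots> = cis t ^ n * of_real (f t)"
      unfolding 1 2 f_def n_def[symmetric]
      by (simp only: of_real_diff of_real_mult of_real_numeral) (simp add: algebra_simps)
    finally show ?thesis .
  qed
  have "cis t0 ^ n * complex_of_real (f t0) \<noteq> 0" using \<open>f t0 \<noteq> 0\<close> unfolding mult_eq_0_iff of_real_eq_0_iff by simp
  then have "p \<noteq> 0" unfolding p_cis[symmetric] by auto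
  have "degree q \<le> n"
    using degree_prod_sum_le[OF \<open>finite I\<close>, of "\<lambda>k. [:Complex (a k / 2) (b k / 2), Complex (a k / 2) (- b k / 2):]"]
      sum_bounded_above[of I "\<lambda>k. degree [:Complex (a k / 2) (b k / 2), Complex (a k / 2) (- b k / 2):]" 1]
    unfolding n_def q_def o_def by force
  moreover have "degree (monom (cis (- (real n * s))) n + [:cis (real n * s):]) \<le> n"
    by (rule degree_add_le) (auto intro: degree_monom_le)
  ultimately have "degree p \<le> n"
    unfolding p_def by (intro degree_diff_le order.trans[OF degree_smult_le])
  define Z where "Z = {t\<in>{s<..<s + pi}. f t = 0}"
  \<comment> \<open>As \<open>t\<close> runs through an open interval of length \<open>pi\<close>,
    \<open>2 * t\<close> makes less than one full turn.\<close>
  have inj: "inj_on (\<lambda>t. cis (2 * t)) Z"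
  proof (rule inj_onI)
    fix x y assume x: "x \<in> Z" and y: "y \<in> Z" and eq: "cis (2 * x) = cis (2 * y)"
    have "cis (2 * x - 2 * y) = 1" using eq by (metis cis_divide cis_neq_zero divide_self)
    then have "cos (2 * x - 2 * y) = 1" by (simp add: complex_eq_iff)
    then obtain k :: int where k: "2 * x - 2 * y = of_int k * 2 * pi"
      using cos_one_2pi_int by auto
    then have "x - y = of_int k * pi" by simp
    moreover have "\<bar>x - y\<bar> < pi" using x y by (auto simp: Z_def)
    ultimately have "\<bar>of_int k :: real\<bar> < 1" by (simp add: abs_mult)
    then have "k = 0" by linarith
    then show "x = y" using k by simp
  qed
  have sub: "(\<lambda>t. cis (2 * t)) ` Z \<subseteq> {z. poly p z = 0}"
    using p_cis by (auto simp: Z_def)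
  have fin: "finite {z. poly p z = 0}" using \<open>p \<noteq> 0\<close> by (rule poly_roots_finite)
  show "finite {t\<in>{s<..<s + pi}. f t = 0}"
    using finite_imageD[OF finite_subset[OF sub fin] inj] by (simp add: Z_def)
  have "card Z \<le> card {z. poly p z = 0}"
    using card_mono[OF fin sub] card_image[OF inj] by simp
  also have "\<dots> \<le> degree p" using \<open>p \<noteq> 0\<close> by (rule card_poly_roots_bound)
  finally show "card {t\<in>{s<..<s + pi}. f t = 0} \<le> card I"
    using \<open>degree p \<le> n\<close> by (simp add: Z_def n_def)
qed

text \<open>The intermediate value theorem puts a zero strictly inside each gap between neighbouring
  points. Finiteness is assumed because \<open>card\<close> of an infinite set is 0.\<close>

lemma sign_changes_le_card_zeros:
  fixes f :: "real \<Rightarrow> real" and x :: "nat \<Rightarrow> real"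
  assumes "continuous_on UNIV f"
    and "\<And>i. i < m \<Longrightarrow> x i < x (Suc i)" and "\<And>i. i < m \<Longrightarrow> f (x i) * f (x (Suc i)) < 0"
    and "finite {t\<in>{x 0<..<x m}. f t = 0}"
  shows "m \<le> card {t\<in>{x 0<..<x m}. f t = 0}"
  using assms(2-)
proof (induction m)
  case (Suc m)
  have "x 0 \<le> x j" if "j \<le> m" for j
    using that
  proof (induction j)
    case (Suc j)
    then show ?case using Suc.prems Suc.IH \<open>\<And>i. i < Suc m \<Longrightarrow> x i < x (Suc i)\<close>[of j] by simp
  qed simp
  then have "x 0 \<le> x m" by simp
  have lt: "x m < x (Suc m)" using Suc.prems(1) by simp
  have "f (x m) * f (x (Suc m)) < 0" using Suc.prems(2) by simp
  then have "f (x m) < 0 \<and> 0 < f (x (Suc m)) \<or> f (x (Suc m)) < 0 \<and> 0 < f (x m)"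
    by (auto simp: mult_less_0_iff)
  moreover have "continuous_on {x m..x (Suc m)} f"
    using assms(1) continuous_on_subset by blast
  ultimately obtain z where z: "x m \<le> z" "z \<le> x (Suc m)" "f z = 0"
    using IVT'[of f "x m" 0 "x (Suc m)"] IVT2'[of f "x (Suc m)" 0 "x m"] lt
    by (metis less_imp_le)
  then have z': "x m < z" "z < x (Suc m)"
    using \<open>f (x m) * f (x (Suc m)) < 0\<close> by (auto simp: order.order_iff_strict)
  let ?A = "{t\<in>{x 0<..<x m}. f t = 0}" and ?B = "{t\<in>{x 0<..<x (Suc m)}. f t = 0}"
  have sub: "insert z ?A \<subseteq> ?B" using z z' lt \<open>x 0 \<le> x m\<close> by auto
  then have fin: "finite ?A" using Suc.prems(3) by (meson finite_insert finite_subset)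
  have "m \<le> card ?A" using Suc fin by simp
  then have "Suc m \<le> card (insert z ?A)" using z' fin by simp
  also have "\<dots> \<le> card ?B" using sub Suc.prems(3) by (rule card_mono[rotated])
  finally show ?case .
qed simp

section \<open>Distance from a maximum to the nearest zero\<close>

text \<open>M. Riesz's comparison with a cosine wave: a zero at \<theta> would give the difference
  \<open>n + 2\<close> zeros in an open interval of length \<open>pi\<close>, where at most
  \<open>n\<close> are possible.\<close>

lemma trig_form_pos_half_wave:
  fixes a b :: "'i \<Rightarrow> real" and I :: "'i set" and C \<theta> :: real
  defines "T \<equiv> \<lambda>t. C * (\<Prod>k\<in>I. a k * cos t + b k * sin t)"
  assumes "finite I" and "card I \<noteq> 0" and T0: "T 0 = 1" and T1: "\<And>t. \<bar>T t\<bar> \<le> 1"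
    and \<theta>: "0 < \<theta>" "\<theta> < pi / (2 * real (card I))"
  shows "T \<theta> \<noteq> 0"
proof
  assume T\<theta>: "T \<theta> = 0"
  define n where "n = card I"
  have n: "real n > 0" using \<open>card I \<noteq> 0\<close> by (metis n_def neq0_conv of_nat_0_less_iff)
  have "real n * \<theta> < pi / 2" using \<theta>(2) n by (simp add: n_def field_simps)
  \<comment> \<open>The cosine wave \<open>L * cos (n * (t + \<sigma>))\<close> lies above \<open>T\<close> at \<open>- \<sigma>\<close>, below it at \<open>0\<close> and above it at \<open>\<theta>\<close>.
    Their difference thus has two sign changes more than the \<open>n\<close> forced by the extrema of the wave.\<close>
  define \<sigma> where "\<sigma> = (pi / (2 * real n) - \<theta>) / 2"
  have \<sigma>: "\<sigma> > 0" using \<theta> by (simp add: \<sigma>_def n_def)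
  \<comment> \<open>\<theta> + \<sigma> is the midpoint of \<theta> and \<open>pi / (2 * n)\<close>,
    so the shifted wave is still positive at \<theta>.\<close>
  have n\<sigma>: "real n * (\<theta> + \<sigma>) < pi / 2"
    using \<open>real n * \<theta> < pi / 2\<close> n by (simp add: \<sigma>_def field_simps)
  have pos: "real n * \<sigma> > 0" "real n * \<theta> > 0" using n \<sigma> \<theta> by auto
  have small: "real n * \<sigma> < pi / 2" using n\<sigma> pos by (simp add: distrib_left)
  have cos_pos: "cos (real n * \<sigma>) > 0" using pos small by (intro cos_gt_zero) auto
  have cos_lt: "cos (real n * \<sigma>) < 1"
    using cos_monotone_0_pi[of 0 "real n * \<sigma>"] pos small by simp
  \<comment> \<open>\<open>L > 1\<close> makes the wave exceed the bound on \<open>T\<close>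
    strictly at its extrema; the upper bound keeps it below \<open>T 0 = 1\<close> at 0.\<close>
  obtain L where L: "1 < L" "L < 1 / cos (real n * \<sigma>)"
    using dense[of 1 "1 / cos (real n * \<sigma>)"] cos_pos cos_lt by (auto simp: field_simps)
  define f where "f = (\<lambda>t. L * cos (real n * (t - (- \<sigma>))) - T t)"
  \<comment> \<open>The points are -\<sigma>, 0, \<theta>, followed by the extrema of the wave
    numbered \<open>k = 1, 2, ...\<close>, which get index \<open>k + 2\<close>. This shift
    preserves parity, so \<open>f (x i)\<close> has the sign of \<open>(- 1) ^ i\<close>
    throughout.\<close>
  define x where "x i = (if i = 1 then 0 else if i = 2 then \<theta>
      else if i = 0 then - \<sigma> else real (i - 2) * pi / real n - \<sigma>)" for i :: nat
  have f_ext: "(- 1) ^ k * f (real k * pi / real n - \<sigma>) > 0" for k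
  proof -
    have "f (real k * pi / real n - \<sigma>) = L * (- 1) ^ k - T (real k * pi / real n - \<sigma>)"
      using n by (simp add: f_def cos_npi)
    moreover have "(- 1) ^ k * (L * (- 1) ^ k) = L" by (cases "even k") simp_all
    moreover have "\<bar>(- 1) ^ k * T (real k * pi / real n - \<sigma>)\<bar> \<le> 1"
      using T1 by (simp add: abs_mult power_abs)
    ultimately show ?thesis using L(1) by (simp only: right_diff_distrib)
  qed
  have f_sign: "(- 1) ^ i * f (x i) > 0" for i
  proof -
    consider "i = 0" | "i = 1" | "i = 2" | k where "i = Suc (Suc k)" "k > 0"
      by (metis One_nat_def Suc_1 gr0_conv_Suc not0_implies_Suc zero_less_Suc)
    then show ?thesis
    proof cases
      case 1
      then show ?thesis using f_ext[of 0] by (simp add: x_def)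
    next
      case 2
      then show ?thesis using L(2) cos_pos T0 by (simp add: x_def f_def field_simps)
    next
      case 3
      have "cos (real n * (\<theta> + \<sigma>)) > 0"
        using n\<sigma> pos by (intro cos_gt_zero) (auto simp: distrib_left)
      then show ?thesis using 3 L(1) T\<theta> by (simp add: x_def f_def)
    next
      case 4
      then show ?thesis using f_ext[of k] by (simp add: x_def)
    qed
  qed
  have alt: "f (x i) * f (x (Suc i)) < 0" for i
    using f_sign[of i] f_sign[of "Suc i"] by (cases "even i") (auto simp: mult_less_0_iff)
  have step: "x i < x (Suc i)" if "i < n + 2" for i
  proof -
    consider "i = 0" | "i = 1" | "i = 2" | "i > 2" by linarith
    then show ?thesis
    proof cases
      case 3
      have "\<theta> + \<sigma> < pi / (2 * real n)" using n\<sigma> n by (simp add: field_simps)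
      also have "\<dots> < pi / real n" using n by (simp add: field_simps)
      finally show ?thesis using 3 by (simp add: x_def)
    next
      case 4
      then have "real (i - 2) < real (Suc i - 2)" by simp
      then show ?thesis using 4 n by (simp add: x_def divide_strict_right_mono)
    qed (use \<sigma> \<theta> in \<open>auto simp: x_def\<close>)
  qed
  \<comment> \<open>The points span exactly the length \<open>pi\<close> to which the zero count
    applies.\<close>
  have ends: "x 0 = - \<sigma>" "x (n + 2) = - \<sigma> + pi" using n by (auto simp: x_def)
  have "f (x 0) \<noteq> 0" using f_sign[of 0] by auto
  have zeros: "finite {t\<in>{- \<sigma><..<- \<sigma> + pi}. f t = 0}" "card {t\<in>{- \<sigma><..<- \<sigma> + pi}. f t = 0} \<le> n"
    using card_zeros_trig_form_le[OF \<open>finite I\<close>, where L = L and C = C and s = "- \<sigma>" and a = a and b = b and ?t0.0 = "x 0"]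
      \<open>f (x 0) \<noteq> 0\<close> unfolding f_def T_def n_def by auto
  have "continuous_on UNIV f" unfolding f_def T_def by (intro continuous_intros)
  then have "n + 2 \<le> card {t\<in>{x 0<..<x (n + 2)}. f t = 0}"
    using sign_changes_le_card_zeros[of f "n + 2" x] alt step zeros ends by simp
  then show False using zeros ends by simp
qed

text \<open>Negative angles reduce to positive ones by reflecting \<open>t\<close> to
  \<open>- t\<close>, which only negates the coefficients \<open>b k\<close>.\<close>

lemma trig_form_nonzero_near_max:
  fixes a b :: "'i \<Rightarrow> real" and I :: "'i set" and C \<theta> :: real
  defines "T \<equiv> \<lambda>t. C * (\<Prod>k\<in>I. a k * cos t + b k * sin t)"
  assumes "finite I" and "card I \<noteq> 0" and T0: "T 0 = 1" and T1: "\<And>t. \<bar>T t\<bar> \<le> 1"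
    and \<theta>: "\<bar>\<theta>\<bar> < pi / (2 * real (card I))"
  shows "T \<theta> \<noteq> 0"
proof -
  consider "\<theta> = 0" | "\<theta> > 0" | "\<theta> < 0" by linarith
  then show ?thesis
  proof cases
    case 1
    then show ?thesis using T0 by simp
  next
    case 2
    then show ?thesis
      using trig_form_pos_half_wave[of I C a b \<theta>] assms by simp
  next
    case 3
    have "\<bar>C * (\<Prod>k\<in>I. a k * cos t + - b k * sin t)\<bar> \<le> 1" for t
      using T1[of "- t"] by (simp add: T_def)
    then show ?thesis
      using trig_form_pos_half_wave[of I C a "\<lambda>k. - b k" "- \<theta>"] 3 assms by simp
  qed
qed

section \<open>Compactness of unit spheres in finite-dimensional spans\<close>

text \<open>Gram-Schmidt by induction: a new vector contributes its normalised residue after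
  projection, or nothing if the residue is 0.\<close>

lemma ex_orthonormal_spanning:
  fixes B :: "'a :: real_inner set"
  assumes "finite B"
  shows "\<exists>C. finite C \<and> (\<forall>x\<in>C. \<forall>y\<in>C. inner x y = (if x = y then 1 else 0)) \<and> span C = span B"
  using assms
proof (induction B)
  case empty
  show ?case by (intro exI[of _ "{}"]) simp
next
  case (insert b B)
  then obtain C where C: "finite C" "\<forall>x\<in>C. \<forall>y\<in>C. inner x y = (if x = y then 1 else 0)" "span C = span B"
    by auto
  define p where "p = (\<Sum>c\<in>C. inner c b *\<^sub>R c)"
  have p: "p \<in> span C" unfolding p_def by (intro span_sum span_scale span_base)
  have orth: "inner c (b - p) = 0" if "c \<in> C" for c
  proof -
    have "inner c p = (\<Sum>d\<in>C. if d = c then inner c b else 0)"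
      unfolding p_def inner_sum_right using C(2) that by (intro sum.cong) auto
    then show ?thesis using that C(1) by (simp add: inner_diff_right)
  qed
  have span_ins: "span (insert b B) = span (insert (b - p) C)"
  proof -
    have "span (insert b B) = span (insert b C)" using C(3) by (simp add: span_insert)
    also have "\<dots> = span (insert (b - p) C)"
      using p by (intro eq_span_insert_eq) simp
    finally show ?thesis .
  qed
  show ?case
  proof (cases "b - p = 0")
    case True
    then have "span C = span (insert b B)" using span_ins by (simp add: span_insert_0)
    then show ?thesis using C by blast
  next
    case False
    define e where "e = (1 / norm (b - p)) *\<^sub>R (b - p)"
    have e: "inner e e = 1" using False by (simp add: e_def dot_square_norm power2_eq_square)
    have ce: "inner c e = 0" "inner e c = 0" if "c \<in> C" for c
      using orth[OF that] by (simp_all add: e_def inner_commute)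
    have "span (insert e C) = span (insert (b - p) C)"
    proof (rule span_eq[THEN iffD2], intro conjI)
      show "insert e C \<subseteq> span (insert (b - p) C)"
        unfolding e_def by (auto intro: span_base span_scale)
      have "norm (b - p) *\<^sub>R e \<in> span (insert e C)" by (intro span_scale span_base) simp
      then show "insert (b - p) C \<subseteq> span (insert e C)"
        using False by (auto simp: e_def intro: span_base)
    qed
    moreover have "\<forall>x\<in>insert e C. \<forall>y\<in>insert e C. inner x y = (if x = y then 1 else 0)"
      using C(2) ce e by fastforce
    ultimately show ?thesis using C(1) span_ins by (intro exI[of _ "insert e C"]) simp
  qed
qed

text \<open>Each further vector presents the set as a continuous image of the product of
  \<open>{- 1..1}\<close> with the previous compact set.\<close>

lemma compact_bounded_combinations:
  fixes C :: "'a :: real_normed_vector set"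
  assumes "finite C"
  shows "compact {\<Sum>c\<in>C. g c *\<^sub>R c |g. \<forall>c\<in>C. \<bar>g c\<bar> \<le> (1::real)}"
  using assms
proof (induction C)
  case (insert d C)
  let ?K = "\<lambda>C. {\<Sum>c\<in>C. g c *\<^sub>R c |g. \<forall>c\<in>C. \<bar>g c\<bar> \<le> (1::real)}"
  have "?K (insert d C) = (\<lambda>(r, x). r *\<^sub>R d + x) ` ({- 1..1} \<times> ?K C)"
  proof (intro set_eqI iffI)
    fix y assume "y \<in> ?K (insert d C)"
    then obtain g where g: "y = (\<Sum>c\<in>insert d C. g c *\<^sub>R c)" "\<forall>c\<in>insert d C. \<bar>g c\<bar> \<le> 1" by auto
    then have "y = (\<lambda>(r, x). r *\<^sub>R d + x) (g d, \<Sum>c\<in>C. g c *\<^sub>R c)" using insert by simp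
    moreover have "(g d, \<Sum>c\<in>C. g c *\<^sub>R c) \<in> {- 1..1} \<times> ?K C" using g(2) by auto
    ultimately show "y \<in> (\<lambda>(r, x). r *\<^sub>R d + x) ` ({- 1..1} \<times> ?K C)" by blast
  next
    fix y assume "y \<in> (\<lambda>(r, x). r *\<^sub>R d + x) ` ({- 1..1} \<times> ?K C)"
    then obtain r g where y: "y = r *\<^sub>R d + (\<Sum>c\<in>C. g c *\<^sub>R c)" "\<bar>r\<bar> \<le> 1" "\<forall>c\<in>C. \<bar>g c\<bar> \<le> 1" by auto
    have "(\<Sum>c\<in>C. g c *\<^sub>R c) = (\<Sum>c\<in>C. (g(d := r)) c *\<^sub>R c)"
      using insert.hyps by (intro sum.cong) auto
    then have "y = (\<Sum>c\<in>insert d C. (g(d := r)) c *\<^sub>R c)" using y(1) insert.hyps by simp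
    moreover have "\<forall>c\<in>insert d C. \<bar>(g(d := r)) c\<bar> \<le> 1" using y by simp
    ultimately show "y \<in> ?K (insert d C)" by blast
  qed
  moreover have "compact ((\<lambda>(r, x). r *\<^sub>R d + x) ` ({- 1..1} \<times> ?K C))"
    by (intro compact_continuous_image compact_Times insert.IH)
       (auto simp: case_prod_unfold intro!: continuous_intros)
  ultimately show ?case by simp
qed simp

text \<open>Coordinates of a unit vector in an orthonormal spanning set are inner products, hence at
  most 1 in modulus by Cauchy-Schwarz. The sphere is thus a closed subset of a compact set.\<close>

lemma compact_unit_sphere_span:
  fixes B :: "'a :: real_inner set"
  assumes "finite B"
  shows "compact {x \<in> span B. norm x = 1}"
proof -
  obtain C where C: "finite C" "\<forall>x\<in>C. \<forall>y\<in>C. inner x y = (if x = y then 1 else 0)" "span C = span B"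
    using ex_orthonormal_spanning[OF assms] by auto
  let ?K = "{\<Sum>c\<in>C. g c *\<^sub>R c |g. \<forall>c\<in>C. \<bar>g c\<bar> \<le> (1::real)}"
  have closed: "closed {x :: 'a. norm x = 1}" by (rule closed_Collect_eq[OF continuous_on_norm_id continuous_on_const])
  have eq: "{x \<in> span B. norm x = 1} = ?K \<inter> {x. norm x = 1}"
  proof (intro set_eqI iffI)
    fix x assume "x \<in> {x \<in> span B. norm x = 1}"
    then have x: "x \<in> span C" "norm x = 1" using C by auto
    then obtain g where g: "x = (\<Sum>c\<in>C. g c *\<^sub>R c)"
      using span_finite[OF C(1)] by auto
    have "\<bar>g c\<bar> \<le> 1" if "c \<in> C" for c
    proof -
      have "inner c x = (\<Sum>d\<in>C. if d = c then g c else 0)"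
        unfolding g inner_sum_right using C(2) that by (intro sum.cong) auto
      then have "g c = inner c x" using that C(1) by simp
      moreover have "norm c = 1" using C(2) that by (simp add: norm_eq_sqrt_inner)
      ultimately show ?thesis using Cauchy_Schwarz_ineq2[of c x] x(2) by simp
    qed
    then show "x \<in> ?K \<inter> {x. norm x = 1}" using g x(2) by auto
  next
    fix x assume "x \<in> ?K \<inter> {x. norm x = 1}"
    then show "x \<in> {x \<in> span B. norm x = 1}"
      unfolding C(3)[symmetric] by (auto intro!: span_sum intro: span_scale span_base)
  qed
  show ?thesis
    unfolding eq by (rule compact_Int_closed[OF compact_bounded_combinations[OF C(1)] closed])
qed

section \<open>The maximising vector and its great circles\<close>

text \<open>This ensures that the product of inner products has a nonzero maximum modulus. In the
  induction, a vector good for \<open>B\<close> is moved along \<open>b\<close> by an amount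
  avoiding finitely many bad values.\<close>

lemma ex_nonorthogonal_in_span:
  fixes B :: "'a :: real_inner set"
  assumes "finite B" and "0 \<notin> B"
  shows "\<exists>x\<in>span B. \<forall>b\<in>B. inner b x \<noteq> 0"
  using assms
proof (induction B)
  case (insert b B)
  then obtain x where x: "x \<in> span B" "\<forall>c\<in>B. inner c x \<noteq> 0" by auto
  have b: "inner b b \<noteq> 0" using insert.prems by simp
  have "infinite (UNIV :: real set)" by (rule infinite_UNIV_char_0)
  \<comment> \<open>For \<open>c\<close> orthogonal to \<open>b\<close> the quotient is 0 by
    convention, which merely excludes \<open>r = 0\<close>; such a \<open>c\<close> lies in
    \<open>B\<close> and its inner product does not change.\<close>
  then obtain r where r: "r \<notin> (\<lambda>c. - inner c x / inner c b) ` insert b B"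
    using insert.hyps by (meson ex_new_if_finite finite_imageI finite_insert)
  have "inner c (x + r *\<^sub>R b) \<noteq> 0" if "c \<in> insert b B" for c
  proof (cases "inner c b = 0")
    case True
    then show ?thesis using that x(2) b by (auto simp: inner_add_right)
  next
    case False
    have "r \<noteq> - inner c x / inner c b" using r that by blast
    then show ?thesis using False by (auto simp: inner_add_right field_simps add_eq_0_iff)
  qed
  moreover have "x + r *\<^sub>R b \<in> span (insert b B)"
    using x(1) span_mono[of B "insert b B"] by (intro span_add span_scale) (auto intro: span_base)
  ultimately show ?case by blast
qed simp

theorem theorem1p3:
  fixes v :: "nat \<Rightarrow> 'a :: {real_inner, complete_space}" and n :: nat
  assumes "n \<ge> 1"
    and "\<forall>k\<in>{1..n}. norm (v k) = 1"
  shows "\<exists>u :: 'a. norm u = 1 \<and> (\<forall>k\<in>{1..n}. \<bar>inner (v k) u\<bar> \<ge> sin (pi / (2 * real n)))"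
proof -
  define B where "B = v ` {1..n}"
  define S where "S = {x \<in> span B. norm x = 1}"
  \<comment> \<open>The product runs over indices, so repeated vectors count with multiplicity and
    the degree is exactly \<open>n\<close>.\<close>
  define P where "P x = (\<Prod>k\<in>{1..n}. inner (v k) x)" for x
  have finB: "finite B" by (simp add: B_def)
  have "0 \<notin> B" using assms(2) by (auto simp: B_def)
  obtain x where x: "x \<in> span B" "\<forall>b\<in>B. inner b x \<noteq> 0"
    using ex_nonorthogonal_in_span[OF finB \<open>0 \<notin> B\<close>] by auto
  have "v 1 \<in> B" using assms(1) by (auto simp: B_def)
  then have "x \<noteq> 0" using x(2) by auto
  define y where "y = (1 / norm x) *\<^sub>R x"
  have y: "y \<in> S" "P y \<noteq> 0"
    using x \<open>x \<noteq> 0\<close> by (auto simp: S_def y_def P_def B_def intro: span_scale)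
  have "compact S" unfolding S_def using finB by (rule compact_unit_sphere_span)
  moreover have "continuous_on S (\<lambda>x. \<bar>P x\<bar>)" unfolding P_def by (intro continuous_intros)
  ultimately obtain w where w: "w \<in> S" "\<And>z. z \<in> S \<Longrightarrow> \<bar>P z\<bar> \<le> \<bar>P w\<bar>"
    using continuous_attains_sup[of S "\<lambda>x. \<bar>P x\<bar>"] y(1) by blast
  have Pw: "P w \<noteq> 0" using w(2)[OF y(1)] y(2) by auto
  have norm_w: "norm w = 1" and span_w: "w \<in> span B" using w(1) by (auto simp: S_def)
  have "\<bar>inner (v k) w\<bar> \<ge> sin (pi / (2 * real n))" if k: "k \<in> {1..n}" for k
  proof (rule ccontr)
    assume less: "\<not> ?thesis"
    define a where "a = inner (v k) w"
    \<comment> \<open>\<phi> is the signed angle between \<open>w\<close> and the hyperplane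
      orthogonal to \<open>v k\<close>.\<close>
    define \<phi> where "\<phi> = arcsin a"
    have a1: "\<bar>a\<bar> < 1" using less sin_le_one[of "pi / (2 * real n)"] unfolding a_def by linarith
    have sin\<phi>: "sin \<phi> = a" using a1 by (simp add: \<phi>_def)
    have bnd: "0 \<le> pi / (2 * real n)" "pi / (2 * real n) \<le> pi / 2" using assms(1) by (auto simp: field_simps)
    have \<phi>: "- (pi / 2) < \<phi>" "\<phi> < pi / 2" using a1 arcsin_lt_bounded[of a] by (auto simp: \<phi>_def)
    have "sin \<phi> < sin (pi / (2 * real n))" "sin (- \<phi>) < sin (pi / (2 * real n))"
      using less sin\<phi> by (auto simp: a_def)
    then have "\<phi> < pi / (2 * real n)" "- \<phi> < pi / (2 * real n)"
      using sin_mono_less_eq[of \<phi> "pi / (2 * real n)"] sin_mono_less_eq[of "- \<phi>" "pi / (2 * real n)"] bnd \<phi>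
      by linarith+
    then have small: "\<bar>- \<phi>\<bar> < pi / (2 * real n)" by simp
    have cos\<phi>: "cos \<phi> > 0" using \<phi> by (intro cos_gt_zero_pi)
    have ww: "inner w w = 1" using norm_w by (simp add: dot_square_norm)
    have vv: "inner (v k) (v k) = 1" using assms(2) k by (simp add: dot_square_norm)
    \<comment> \<open>\<open>u\<close> is the normalised component of \<open>v k\<close> orthogonal
      to \<open>w\<close>. On the circle through \<open>w\<close> and \<open>u\<close> the inner
      product with \<open>v k\<close> is \<open>sin (t + \<phi>)\<close>, which vanishes at
      -\<phi>.\<close>
    define u where "u = (1 / cos \<phi>) *\<^sub>R (v k - a *\<^sub>R w)"
    have wu: "inner w u = 0" "inner u w = 0"
      by (simp_all add: u_def a_def inner_diff_right inner_diff_left ww inner_commute)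
    have vu: "inner (v k) u = cos \<phi>"
    proof -
      have "inner (v k) u = (1 - a\<^sup>2) / cos \<phi>"
        by (simp add: u_def inner_diff_right vv a_def power2_eq_square)
      also have "1 - a\<^sup>2 = cos \<phi> * cos \<phi>"
        using sin_cos_squared_add[of \<phi>] sin\<phi> by (simp add: power2_eq_square)
      finally show ?thesis using cos\<phi> by simp
    qed
    have uu: "inner u u = 1"
    proof -
      have "inner u u = inner (v k - a *\<^sub>R w) u / cos \<phi>" by (simp add: u_def)
      then show ?thesis using vu wu cos\<phi> by (simp add: inner_diff_left)
    qed
    \<comment> \<open>The circle must stay in \<open>span B\<close>, since \<open>w\<close> is
      maximal only there.\<close>
    have "v k \<in> span B" using k by (auto simp: B_def intro: span_base)
    then have u_span: "u \<in> span B" unfolding u_def using span_w by (intro span_scale span_diff)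
    have circle: "cos t *\<^sub>R w + sin t *\<^sub>R u \<in> S" for t
    proof -
      have "inner (cos t *\<^sub>R w + sin t *\<^sub>R u) (cos t *\<^sub>R w + sin t *\<^sub>R u) = 1"
        using sin_cos_squared_add[of t]
        by (simp add: inner_add_left inner_add_right ww uu wu power2_eq_square)
      then show ?thesis
        using span_w u_span by (simp add: S_def norm_eq_sqrt_inner span_add span_scale)
    qed
    have P_circle: "P (cos t *\<^sub>R w + sin t *\<^sub>R u)
        = (\<Prod>j\<in>{1..n}. inner (v j) w * cos t + inner (v j) u * sin t)" for t
      by (simp add: P_def inner_add_right mult.commute)
    \<comment> \<open>Dividing by \<open>P w\<close> normalises the form to the value 1 at
      \<open>t = 0\<close>, whatever the sign of \<open>P w\<close>.\<close>
    have T1: "\<bar>1 / P w * P (cos t *\<^sub>R w + sin t *\<^sub>R u)\<bar> \<le> 1" for t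
      using w(2)[OF circle[of t]] Pw by (simp add: abs_mult divide_simps)
    have T0: "1 / P w * P (cos 0 *\<^sub>R w + sin 0 *\<^sub>R u) = 1" using Pw by simp
    have I: "card {1..n} \<noteq> 0" "\<bar>- \<phi>\<bar> < pi / (2 * real (card {1..n}))"
      using assms(1) small by simp_all
    have "1 / P w * P (cos (- \<phi>) *\<^sub>R w + sin (- \<phi>) *\<^sub>R u) \<noteq> 0"
      unfolding P_circle
      by (rule trig_form_nonzero_near_max[OF _ I(1) T0[unfolded P_circle] T1[unfolded P_circle] I(2)]) simp
    moreover have "inner (v k) (cos (- \<phi>) *\<^sub>R w + sin (- \<phi>) *\<^sub>R u) = 0"
      using sin\<phi> vu by (simp add: inner_diff_right a_def mult.commute)
    then have "P (cos (- \<phi>) *\<^sub>R w + sin (- \<phi>) *\<^sub>R u) = 0"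
      unfolding P_def using k by (intro prod_zero) auto
    ultimately show False by simp
  qed
  then show ?thesis using norm_w by blast
qed

end
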